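(* Let $k$ be a field of characteristic $2$. Let $r>s\ge 1$ be integers and let $m=\gcd(r,s)$. Then $$[S:k(N_{2^r+1},N_{2^s+1},N_1)]=2^{m-1}.$$
   Context: $F=k(x,y)$ is the field of rational functions in two algebraically independent transcendentals $x,y$ over $k$, and $S\subset F$ is the subfield of symmetric functions, i.e. the elements of $F$ fixed by the $k$-automorphism exchanging $x$ and $y$. For $j\ge 1$, $N_j=x^j+y^j$, and $k(N_{2^r+1},N_{2^s+1},N_1)$ is the subfield of $F$ generated over $k$ by these three polynomials. *)

theory Defs
  imports "HOL-Algebra.Algebra"
begin

(* The additive order of 1, with 0 standing for infinite order; the same convention as CHAR
   for type-class rings. *)
definition has_characteristic :: "('a, 'b) ring_scheme \<Rightarrow> nat \<Rightarrow> bool"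
  where "has_characteristic R p \<longleftrightarrow>
    (\<forall>n::nat. [n] \<cdot>\<^bsub>R\<^esub> \<one>\<^bsub>R\<^esub> = \<zero>\<^bsub>R\<^esub> \<longleftrightarrow> p dvd n)"

(* c i j is the coefficient of X^i Y^j; every bivariate polynomial has degree at most n in each
   of its variables for some n. *)
definition alg_independent2 :: "('a, 'b) ring_scheme \<Rightarrow> 'a set \<Rightarrow> 'a \<Rightarrow> 'a \<Rightarrow> bool"
  where "alg_independent2 F k x y \<longleftrightarrow>
    (\<forall>(n::nat) (c :: nat \<Rightarrow> nat \<Rightarrow> 'a).
       (\<forall>i\<le>n. \<forall>j\<le>n. c i j \<in> k) \<longrightarrow>
       (\<Oplus>\<^bsub>F\<^esub>i\<in>{..n}. \<Oplus>\<^bsub>F\<^esub>j\<in>{..n}.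
          c i j \<otimes>\<^bsub>F\<^esub> (x [^]\<^bsub>F\<^esub> i) \<otimes>\<^bsub>F\<^esub> (y [^]\<^bsub>F\<^esub> j)) = \<zero>\<^bsub>F\<^esub> \<longrightarrow>
       (\<forall>i\<le>n. \<forall>j\<le>n. c i j = \<zero>\<^bsub>F\<^esub>))"

definition exchange_automorphism ::
    "('a, 'b) ring_scheme \<Rightarrow> 'a set \<Rightarrow> 'a \<Rightarrow> 'a \<Rightarrow> ('a \<Rightarrow> 'a) \<Rightarrow> bool"
  where "exchange_automorphism F k x y \<sigma> \<longleftrightarrow>
    \<sigma> \<in> ring_iso F F \<and> (\<forall>a\<in>k. \<sigma> a = a) \<and> \<sigma> x = y \<and> \<sigma> y = x"

(* In F = k(x,y) there is exactly one exchange automorphism as a map on the carrier; the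
   quantifier only accounts for the arbitrary values of a HOL function off the carrier. *)
definition symmetric_functions :: "('a, 'b) ring_scheme \<Rightarrow> 'a set \<Rightarrow> 'a \<Rightarrow> 'a \<Rightarrow> 'a set"
  where "symmetric_functions F k x y =
    {f \<in> carrier F. \<forall>\<sigma>. exchange_automorphism F k x y \<sigma> \<longrightarrow> \<sigma> f = f}"

definition power_sum2 :: "('a, 'b) ring_scheme \<Rightarrow> 'a \<Rightarrow> 'a \<Rightarrow> nat \<Rightarrow> 'a"
  where "power_sum2 F x y j = x [^]\<^bsub>F\<^esub> j \<oplus>\<^bsub>F\<^esub> y [^]\<^bsub>F\<^esub> j"

end

theory Submission
  imports Defs
begin

text \<open>
  Put \<open>e = N\<^sub>1 = x + y\<close>, \<open>t = y / e\<close> and \<open>A\<^sub>j = t\<^bsup>2^j\<^esup> + t\<close>. Since \<open>x = e (t + 1)\<close>,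
  \<open>N\<^bsub>2^j+1\<^esub> = e\<^bsup>2^j+1\<^esup> (A\<^sub>j + 1)\<close>, so the field in question is \<open>k(e, A\<^sub>r, A\<^sub>s)\<close>.
  From \<open>A\<^bsub>i+j\<^esub> = A\<^sub>i\<^bsup>2^j\<^esup> + A\<^sub>j\<close> the Euclidean algorithm on \<open>r\<close>, \<open>s\<close> shows that it equals \<open>k(e, A\<^sub>m)\<close>.
  As \<open>t\<close> is transcendental over \<open>k(e)\<close>, the degree of \<open>F = k(e)(t)\<close> over it is \<open>2\<^sup>m\<close>.
  The exchange of \<open>x\<close> and \<open>y\<close> sends \<open>t\<close> to \<open>t + 1\<close>, so \<open>S = k(e, A\<^sub>1)\<close>, over which \<open>F\<close> has degree \<open>2\<close>.
\<close>

section \<open>Degrees over a subfield generated by a polynomial in a transcendental\<close>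

text \<open>A relation, since \<open>f\<close> determines its degree in \<open>t\<close> only when
  \<open>t\<close> is transcendental over \<open>K\<close>. Excluding \<open>[]\<close>, whose list
  degree is 0, keeps zero apart from the nonzero constants.\<close>

definition (in ring) has_degree :: "'a set \<Rightarrow> 'a \<Rightarrow> nat \<Rightarrow> 'a \<Rightarrow> bool"
  where "has_degree K t n f \<longleftrightarrow> (\<exists>p. polynomial K p \<and> p \<noteq> [] \<and> degree p = n \<and> eval p t = f)"

context domain
begin

lemma has_degree_closed:
  assumes "subring K R" "t \<in> carrier R" "has_degree K t n f"
  shows "f \<in> carrier R"
  using assms eval_poly_in_carrier unfolding has_degree_def by blast

text \<open>This is where transcendence enters the degree calculus: an expression that has a degree
  comes from a nonzero polynomial, which cannot vanish at \<open>t\<close>.\<close>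

lemma has_degree_nonzero:
  assumes "(transcendental over K) t" "has_degree K t n f"
  shows "f \<noteq> \<zero>"
  using assms eval_transcendental unfolding has_degree_def univ_poly_carrier by blast

lemma has_degree_mult:
  assumes "subring K R" "t \<in> carrier R" "has_degree K t n f" "has_degree K t m g"
  shows "has_degree K t (n + m) (f \<otimes> g)"
proof -
  obtain p q where p: "polynomial K p" "p \<noteq> []" "degree p = n" "eval p t = f"
    and q: "polynomial K q" "q \<noteq> []" "degree q = m" "eval q t = g"
    using assms(3,4) unfolding has_degree_def by blast
  have "poly_mult p q \<noteq> []"
    using poly_mult_integral[OF assms(1) p(1) q(1)] p(2) q(2) by blast
  moreover have "eval (poly_mult p q) t = f \<otimes> g"
    using eval_poly_mult[of p q t] p q polynomial_in_carrier[OF assms(1)] assms(2) by simp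
  ultimately show ?thesis
    using poly_mult_closed[OF assms(1) p(1) q(1)] poly_mult_degree_eq[OF assms(1) p(1) q(1)] p q
    unfolding has_degree_def by auto
qed

lemma has_degree_add:
  assumes "subring K R" "t \<in> carrier R" "has_degree K t n f" "has_degree K t m g" "n \<noteq> m"
  shows "has_degree K t (max n m) (f \<oplus> g)"
proof -
  obtain p q where p: "polynomial K p" "p \<noteq> []" "degree p = n" "eval p t = f"
    and q: "polynomial K q" "q \<noteq> []" "degree q = m" "eval q t = g"
    using assms(3,4) unfolding has_degree_def by blast
  have deg: "degree (poly_add p q) = max n m"
    using poly_add_degree_eq[OF assms(1) p(1) q(1)] p(3) q(3) assms(5) by simp
  moreover have "eval (poly_add p q) t = f \<oplus> g"
    using eval_poly_add[of p q t] p q polynomial_in_carrier[OF assms(1)] assms(2) by simp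
  moreover have "poly_add p q \<noteq> []"
    using deg assms(5) by auto
  ultimately show ?thesis
    using poly_add_closed[OF assms(1) p(1) q(1)] unfolding has_degree_def by blast
qed

lemma has_degree_const:
  assumes "subring K R" "t \<in> carrier R" "a \<in> K" "a \<noteq> \<zero>"
  shows "has_degree K t 0 a"
proof -
  have "polynomial K [a]" "eval [a] t = a"
    using assms subringE(1)[OF assms(1)] by (auto simp: polynomial_def)
  thus ?thesis unfolding has_degree_def by force
qed

lemma has_degree_self:
  assumes "subring K R" "t \<in> carrier R"
  shows "has_degree K t 1 t"
proof -
  have "polynomial K [\<one>, \<zero>]" "eval [\<one>, \<zero>] t = t"
    using assms subringE(2,3)[OF assms(1)] by (auto simp: polynomial_def)
  thus ?thesis unfolding has_degree_def by force
qed

lemma has_degree_pow: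
  assumes "subring K R" "t \<in> carrier R" "has_degree K t n f"
  shows "has_degree K t (n * i) (f [^] (i::nat))"
proof (induct i)
  case 0
  show ?case using has_degree_const[OF assms(1,2)] subringE(3)[OF assms(1)] by simp
next
  case (Suc i)
  show ?case using has_degree_mult[OF assms(1,2) Suc assms(3)] by (simp add: add.commute)
qed

text \<open>The nonzero terms \<open>a\<^sub>i w\<^sup>i\<close> have pairwise distinct degrees in \<open>t\<close>, so nothing cancels.\<close>

lemma has_degree_eval:
  assumes "subring K R" "t \<in> carrier R" "has_degree K t d w" "d \<ge> 1"
  shows "set p \<subseteq> K \<Longrightarrow>
    (eval p w = \<zero> \<and> set p \<subseteq> {\<zero>}) \<or> (\<exists>n < length p. has_degree K t (d * n) (eval p w))"
proof (induct p)
  case Nil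
  show ?case by simp
next
  case (Cons a p)
  have w: "w \<in> carrier R" using has_degree_closed assms by blast
  have a: "a \<in> K" "a \<in> carrier R" and p: "set p \<subseteq> carrier R"
    using Cons(2) subringE(1)[OF assms(1)] by auto
  have ev: "eval p w \<in> carrier R" using eval_in_carrier[OF p w] .
  show ?case
  proof (cases "a = \<zero>")
    case True
    have "eval (a # p) w = eval p w" using True ev w by simp
    thus ?thesis using Cons True by (auto intro: less_SucI)
  next
    case False
    \<comment> \<open>Coefficient lists begin with the leading term, so the head \<open>a\<close>
      belongs to the exponent \<open>length p\<close> and the tail has strictly smaller
      degree.\<close>
    have top: "has_degree K t (d * length p) (a \<otimes> w [^] length p)"
      using has_degree_mult[OF assms(1,2) has_degree_const[OF assms(1,2) a(1) False]
          has_degree_pow[OF assms(1-3)]] by simp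
    have "has_degree K t (d * length p) (eval (a # p) w)"
    proof (cases "eval p w = \<zero>")
      case True
      thus ?thesis using top w a by simp
    next
      case False
      then obtain n where n: "n < length p" "has_degree K t (d * n) (eval p w)"
        using Cons by auto
      have "d * n < d * length p" using n(1) assms(4) by simp
      thus ?thesis using has_degree_add[OF assms(1,2) top n(2)] by (simp add: max_def)
    qed
    thus ?thesis by auto
  qed
qed

text \<open>A relation for \<open>w\<close> over \<open>K\<close> turns into an expression in
  \<open>t\<close> that has a degree, hence is nonzero, unless all its coefficients are
  zero.\<close>

lemma transcendental_if_has_degree:
  assumes "subring K R" "t \<in> carrier R" "(transcendental over K) t" "has_degree K t d w" "d \<ge> 1"
  shows "(transcendental over K) w"
proof -
  have w: "w \<in> carrier R" using has_degree_closed assms by blast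
  have "p = []" if p: "p \<in> carrier (K[X])" "eval p w = \<zero>" for p
  proof -
    have pol: "polynomial K p" using p by (simp add: univ_poly_carrier)
    have "set p \<subseteq> {\<zero>}"
      using has_degree_eval[OF assms(1,2,4,5) polynomial_incl[OF pol]]
        has_degree_nonzero[OF assms(3)] p by auto
    thus ?thesis using pol by (cases p) (auto simp: polynomial_def)
  qed
  thus ?thesis using algebraicE[OF assms(1) w] unfolding over_def by metis
qed

text \<open>The nonzero terms \<open>a\<^sub>i t\<^sup>i\<close> have degrees in distinct residue classes modulo \<open>d\<close>.\<close>

lemma has_degree_eval_mod:
  assumes "subring K R" "t \<in> carrier R" "has_degree K t d w" "d \<ge> 1"
  shows "set p \<subseteq> simple_extension K w \<Longrightarrow> length p \<le> d \<Longrightarrow>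
    (eval p t = \<zero> \<and> set p \<subseteq> {\<zero>}) \<or> (\<exists>n. n mod d < length p \<and> has_degree K t n (eval p t))"
proof (induct p)
  case Nil
  show ?case by simp
next
  case (Cons a p)
  have w: "w \<in> carrier R" using has_degree_closed assms by blast
  have a: "a \<in> simple_extension K w" "a \<in> carrier R" and p: "set p \<subseteq> carrier R"
    using Cons(2) simple_extension_in_carrier[OF subringE(1)[OF assms(1)] w] by auto
  have ev: "eval p t \<in> carrier R" using eval_in_carrier[OF p assms(2)] .
  show ?case
  proof (cases "a = \<zero>")
    case True
    have "eval (a # p) t = eval p t" using True ev assms(2) by simp
    thus ?thesis using Cons True by (auto intro: less_SucI)
  next
    case False
    obtain A where A: "A \<in> carrier (K[X])" "a = eval A w"
      using a(1) simple_extension_as_eval_img[OF subringE(1)[OF assms(1)] w] by auto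
    have "set A \<subseteq> K" using A(1) polynomial_incl by (simp add: univ_poly_carrier [symmetric])
    \<comment> \<open>A nonzero coefficient is a polynomial in \<open>w\<close>, so its degree in
      \<open>t\<close> is a multiple of \<open>d\<close>.\<close>
    then obtain i where i: "has_degree K t (d * i) a"
      using has_degree_eval[OF assms] A(2) False by blast
    have "has_degree K t (d * i + 1 * length p) (a \<otimes> t [^] length p)"
      using has_degree_mult[OF assms(1,2) i has_degree_pow[OF assms(1,2) has_degree_self[OF assms(1,2)]]] .
    then have top: "has_degree K t (d * i + length p) (a \<otimes> t [^] length p)" by simp
    \<comment> \<open>Since \<open>length (a # p) \<le> d\<close>, the exponent
      \<open>length p\<close> is below \<open>d\<close> and is itself the residue; the tail only has
      smaller residues.\<close>
    have md: "(d * i + length p) mod d = length p" using Cons(3) by simp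
    show ?thesis
    proof (cases "eval p t = \<zero>")
      case True
      thus ?thesis using top a assms(2) md by (intro disjI2 exI[of _ "d * i + length p"]) simp
    next
      case False
      then obtain n where n: "n mod d < length p" "has_degree K t n (eval p t)"
        using Cons by auto
      have "d * i + length p \<noteq> n" using n(1) md by auto
      then have "has_degree K t (max (d * i + length p) n) (eval (a # p) t)"
        using has_degree_add[OF assms(1,2) top n(2)] by simp
      moreover have "max (d * i + length p) n mod d < length (a # p)"
        using n(1) md by (simp add: max_def)
      ultimately show ?thesis by blast
    qed
  qed
qed

end

section \<open>Fractions over K[w] and the degree of K(t) over K(w)\<close>

context field
begin

text \<open>Induction along the generation of the field: denominators multiply under sums and
  products, and for an inverse the numerator becomes the denominator. As
  \<open>simple_extension K w\<close> is the ring K[w], this presents K(w) as its fractions.\<close>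

lemma generate_field_fraction:
  assumes "subring K R" "w \<in> carrier R" "f \<in> generate_field R (insert w K)"
  shows "\<exists>h \<in> simple_extension K w. h \<noteq> \<zero> \<and> h \<otimes> f \<in> simple_extension K w"
proof -
  let ?E = "simple_extension K w"
  have KR: "K \<subseteq> carrier R" using subringE(1)[OF assms(1)] .
  have E: "subring ?E R" using simple_extension_is_subring[OF assms(1,2)] .
  note Es = subringE[OF E]
  have gen: "g \<in> carrier R" if "g \<in> generate_field R (insert w K)" for g
    using generate_field_in_carrier[of "insert w K"] that KR assms(2) by blast
  have car: "g \<in> ?E \<Longrightarrow> g \<in> carrier R" for g using Es(1) by auto
  show ?thesis using assms(3)
  proof (induct f rule: generate_field.induct)
    case one
    show ?case using Es(3) by (intro bexI[of _ \<one>]) auto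
  next
    case (incl h)
    have "h \<in> ?E" using incl simple_extension_incl[OF KR assms(2)] simple_extension_mem[OF assms(1,2)]
      by auto
    thus ?case using Es(3) car by (intro bexI[of _ \<one>]) auto
  next
    case (a_inv f)
    then obtain h where h: "h \<in> ?E" "h \<noteq> \<zero>" "h \<otimes> f \<in> ?E" by blast
    have "h \<otimes> (\<ominus> f) = \<ominus> (h \<otimes> f)" using h car gen[OF a_inv(1)] by (simp add: r_minus)
    thus ?case using h Es(5) by metis
  next
    case (m_inv f)
    then obtain h where h: "h \<in> ?E" "h \<noteq> \<zero>" "h \<otimes> f \<in> ?E" by blast
    have f: "f \<in> carrier R" "f \<noteq> \<zero>" using m_inv gen by auto
    \<comment> \<open>The new denominator is \<open>h \<otimes> f\<close>, nonzero because both
      factors are.\<close>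
    have "(h \<otimes> f) \<otimes> inv f = h" using f h car field_Units by (simp add: m_assoc)
    thus ?case using h f car integral[of h f] by metis
  next
    case (eng_add f g)
    then obtain h h' where h: "h \<in> ?E" "h \<noteq> \<zero>" "h \<otimes> f \<in> ?E"
      and h': "h' \<in> ?E" "h' \<noteq> \<zero>" "h' \<otimes> g \<in> ?E" by blast
    note c = h(1)[THEN car] h'(1)[THEN car] gen[OF eng_add(1)] gen[OF eng_add(3)]
    have "(h \<otimes> h') \<otimes> (f \<oplus> g) = h' \<otimes> (h \<otimes> f) \<oplus> h \<otimes> (h' \<otimes> g)" using c by algebra
    moreover have "h \<otimes> h' \<noteq> \<zero>" using c h h' integral by blast
    ultimately show ?case using h h' Es(6,7) by metis
  next
    case (eng_mult f g)
    then obtain h h' where h: "h \<in> ?E" "h \<noteq> \<zero>" "h \<otimes> f \<in> ?E"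
      and h': "h' \<in> ?E" "h' \<noteq> \<zero>" "h' \<otimes> g \<in> ?E" by blast
    note c = h(1)[THEN car] h'(1)[THEN car] gen[OF eng_mult(1)] gen[OF eng_mult(3)]
    have "(h \<otimes> h') \<otimes> (f \<otimes> g) = (h \<otimes> f) \<otimes> (h' \<otimes> g)" using c by algebra
    moreover have "h \<otimes> h' \<noteq> \<zero>" using c h h' integral by blast
    ultimately show ?case using h h' Es(6) by metis
  qed
qed

text \<open>The product of the single denominators works. It replaces a polynomial over K(w) by a
  multiple with coefficients in K[w].\<close>

lemma generate_field_common_denominator:
  assumes "subring K R" "w \<in> carrier R"
  shows "set p \<subseteq> generate_field R (insert w K) \<Longrightarrow>
    \<exists>h \<in> simple_extension K w. h \<noteq> \<zero> \<and> (\<lambda>a. h \<otimes> a) ` set p \<subseteq> simple_extension K w"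
proof (induct p)
  case Nil
  show ?case using subringE(3)[OF simple_extension_is_subring[OF assms]]
    by (intro bexI[of _ \<one>]) auto
next
  case (Cons a p)
  let ?E = "simple_extension K w"
  note Es = subringE[OF simple_extension_is_subring[OF assms]]
  obtain h where h: "h \<in> ?E" "h \<noteq> \<zero>" "(\<lambda>a. h \<otimes> a) ` set p \<subseteq> ?E" using Cons by auto
  obtain h' where h': "h' \<in> ?E" "h' \<noteq> \<zero>" "h' \<otimes> a \<in> ?E"
    using generate_field_fraction[OF assms, of a] Cons(2) by auto
  have gen: "insert a (set p) \<subseteq> carrier R"
    using generate_field_incl[of "insert w K"] Cons(2) subringE(1)[OF assms(1)] assms(2) by auto
  have c: "h \<in> carrier R" "h' \<in> carrier R" using h h' Es(1) by auto
  have "(h \<otimes> h') \<otimes> b \<in> ?E" if b: "b \<in> set (a # p)" for b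
  proof (cases "b = a")
    case True
    have "(h \<otimes> h') \<otimes> a = h \<otimes> (h' \<otimes> a)" using c gen by (simp add: m_assoc)
    thus ?thesis using True h h' Es(6) by simp
  next
    case False
    then have "b \<in> set p" "b \<in> carrier R" using b gen by auto
    moreover have "(h \<otimes> h') \<otimes> b = h' \<otimes> (h \<otimes> b)" if "b \<in> carrier R"
      using c that by algebra
    ultimately show ?thesis using h h' Es(6) by auto
  qed
  moreover have "h \<otimes> h' \<noteq> \<zero>" using c h h' integral by blast
  ultimately show ?case using h h' Es(6)[of h h'] by (intro bexI[of _ "h \<otimes> h'"]) auto
qed

lemma eval_map_mult:
  assumes "h \<in> carrier R" "t \<in> carrier R" "set p \<subseteq> carrier R"
  shows "eval (map (\<lambda>a. h \<otimes> a) p) t = h \<otimes> eval p t"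
  using assms(3)
  by (induct p) (use assms(1,2) in \<open>auto simp: r_distr m_assoc eval_in_carrier\<close>)

text \<open>After clearing denominators the coefficients lie in K[w], where terms with distinct
  residues modulo \<open>d\<close> cannot cancel. The bound \<open>length p \<le> d\<close> means
  degree below \<open>d\<close>, so this is the lower bound for the degree of \<open>t\<close> over
  K(w).\<close>

lemma no_root_of_small_degree:
  assumes "subring K R" "t \<in> carrier R" "(transcendental over K) t" "has_degree K t d w" "d \<ge> 1"
    and p: "polynomial (generate_field R (insert w K)) p" "length p \<le> d" "eval p t = \<zero>"
  shows "p = []"
proof -
  have w: "w \<in> carrier R" using has_degree_closed assms by blast
  let ?E = "simple_extension K w"
  have pc: "set p \<subseteq> carrier R"
    using generate_field_incl[of "insert w K"] polynomial_incl[OF p(1)] subringE(1)[OF assms(1)] w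
    by auto
  obtain h where h: "h \<in> ?E" "h \<noteq> \<zero>" "(\<lambda>a. h \<otimes> a) ` set p \<subseteq> ?E"
    using generate_field_common_denominator[OF assms(1) w polynomial_incl[OF p(1)]] by blast
  have hc: "h \<in> carrier R" using h(1) simple_extension_in_carrier[OF subringE(1)[OF assms(1)] w] by auto
  let ?p = "map (\<lambda>a. h \<otimes> a) p"
  have "eval ?p t = \<zero>" using eval_map_mult[OF hc assms(2) pc] p(3) hc by simp
  then have "set ?p \<subseteq> {\<zero>}"
    using has_degree_eval_mod[OF assms(1,2,4,5), of ?p] h(3) p(2)
      has_degree_nonzero[OF assms(3)] by auto
  then have "a = \<zero>" if "a \<in> set p" for a
    using that h(2) hc pc integral[of h a] by auto
  thus ?thesis using p(1) by (cases p) (auto simp: polynomial_def)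
qed

text \<open>Up to a constant factor, \<open>t\<close> has minimal polynomial \<open>q - w\<close> over \<open>K(w)\<close>, where \<open>w = q(t)\<close>.\<close>

lemma degree_over_polynomial:
  assumes "subfield K R" "t \<in> carrier R" "(transcendental over K) t" "has_degree K t d w" "d \<ge> 1"
    and gen: "carrier R = generate_field R (insert t K)"
  defines "L \<equiv> generate_field R (insert w K)"
  shows "subfield L R" "(algebraic over L) t" "degree (Irr L t) = d" "simple_extension L t = carrier R"
proof -
  have K: "subring K R" "K \<subseteq> carrier R" using subfieldE[OF assms(1)] by auto
  have w: "w \<in> carrier R" using has_degree_closed[OF K(1)] assms by blast
  show L: "subfield L R" unfolding L_def using generate_field_is_subfield w K by auto
  note Lr = subfieldE(1)[OF L]
  have wL: "w \<in> L" and KL: "K \<subseteq> L" unfolding L_def by (auto intro: generate_field.incl)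
  obtain q where q: "polynomial K q" "q \<noteq> []" "degree q = d" "eval q t = w"
    using assms(4) unfolding has_degree_def by blast
  have qL: "polynomial L q" using q(1) KL unfolding polynomial_def by auto
  \<comment> \<open>\<open>normalize\<close> makes the constant -w a valid polynomial without a case
    distinction on \<open>w = \<zero>\<close>.\<close>
  let ?c = "normalize [\<ominus> w]"
  have c: "polynomial L ?c"
    using normalize_gives_polynomial[of "[\<ominus> w]" L] wL subringE(5)[OF Lr] by auto
  have lc: "length ?c \<le> 1" using normalize_length_le[of "[\<ominus> w]"] by simp
  have ec: "eval ?c t = \<ominus> w" using w assms(2) by simp
  let ?p = "poly_add q ?c"
  have p: "?p \<in> carrier (L[X])" using poly_add_closed[OF Lr qL c] by (simp add: univ_poly_carrier)
  \<comment> \<open>As \<open>d \<ge> 1\<close>, subtracting the constant \<open>w\<close> leaves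
    the leading term of \<open>q\<close> untouched.\<close>
  have len: "length ?p = Suc d"
    using poly_add_length_eq[OF Lr qL c] lc q(2,3) assms(5) by (cases q) auto
  have ep: "eval ?p t = \<zero>"
    using eval_poly_add[OF polynomial_in_carrier[OF Lr qL] polynomial_in_carrier[OF Lr c] assms(2)]
      ec q(4) w r_neg by simp
  have pn: "?p \<noteq> []" using len by auto
  show alg: "(algebraic over L) t" using algebraicI[OF p pn ep] .
  note I = IrrE[OF L assms(2) alg]
  \<comment> \<open>Upper bound: the minimal polynomial divides q - w, which has the root
    \<open>t\<close>.\<close>
  have "degree (Irr L t) \<le> d"
    using pdivides_imp_degree_le[OF Lr I(1) p pn Irr_minimal[OF L assms(2) alg p ep]] len by simp
  moreover have "Irr L t \<noteq> []" using pirreducible_degree[OF L I(1,2)] by auto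
  then have "\<not> length (Irr L t) \<le> d"
    using no_root_of_small_degree[OF K(1) assms(2-5)] I(1,4) unfolding L_def univ_poly_carrier by blast
  ultimately show "degree (Irr L t) = d" by simp
  \<comment> \<open>Because \<open>t\<close> is algebraic over \<open>L\<close>, the ring L[t] is
    already a field; it contains \<open>K\<close> and \<open>t\<close>, hence everything.\<close>
  have "subfield (simple_extension L t) R"
    using simple_extension_is_subfield[OF L assms(2)] alg by simp
  moreover have "insert t K \<subseteq> simple_extension L t"
    using simple_extension_mem[OF Lr assms(2)] simple_extension_incl[OF subringE(1)[OF Lr] assms(2)] KL
    by auto
  ultimately have "carrier R \<subseteq> simple_extension L t"
    using generate_field_min_subfield1[of "insert t K"] gen K assms(2) by auto
  thus "simple_extension L t = carrier R"
    using simple_extension_in_carrier[OF subringE(1)[OF Lr] assms(2)] by auto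
qed

end

section \<open>Algebraic independence and transcendence\<close>

context ring
begin

text \<open>Links Horner evaluation of lists to the sums in \<open>alg_independent2\<close>. The
  slack in \<open>n\<close> allows polynomials of different lengths to be padded to one common
  bound.\<close>

lemma eval_eq_finsum:
  assumes "x \<in> carrier R" "set p \<subseteq> carrier R"
  shows "length p \<le> Suc n \<Longrightarrow> eval p x = (\<Oplus>i\<in>{..n}. coeff p i \<otimes> x [^] i)"
proof -
  have full: "eval (map b (rev [0..<Suc n])) x = (\<Oplus>i\<in>{..n}. b i \<otimes> x [^] i)"
    if "\<And>i. b i \<in> carrier R" for b n
    by (induct n) (use that assms in \<open>auto simp: finsum_Suc a_comm\<close>)
  have c: "coeff p i \<in> carrier R" for i using assms(2) by simp
  show "length p \<le> Suc n \<Longrightarrow> ?thesis"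
  proof (induct n)
    case 0
    then show ?case using assms by (cases p) auto
  next
    case (Suc n)
    show ?case
    proof (cases "length p = Suc (Suc n)")
      case True
      then show ?thesis
        using full[of "coeff p" "Suc n", OF c] coeff_list[of p] by (simp del: upt_Suc)
    next
      case False
      then have "length p \<le> Suc n" using Suc(2) by simp
      then show ?thesis using Suc(1) coeff_length[of p "Suc n"] assms c by (simp add: finsum_Suc)
    qed
  qed
qed

lemma finsum_swap:
  assumes "\<And>i j. i \<le> n \<Longrightarrow> j \<le> m \<Longrightarrow> f i j \<in> carrier R"
  shows "(\<Oplus>i\<in>{..n::nat}. \<Oplus>j\<in>{..m::nat}. f i j) = (\<Oplus>j\<in>{..m}. \<Oplus>i\<in>{..n}. f i j)"
  using assms
proof (induct n)
  case 0
  have "(\<Oplus>i\<in>{..0::nat}. \<Oplus>j\<in>{..m}. f i j) = (\<Oplus>j\<in>{..m}. f 0 j)"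
    using 0 by (subst finsum_0) auto
  also have "\<dots> = (\<Oplus>j\<in>{..m}. \<Oplus>i\<in>{..0::nat}. f i j)"
    using 0 by (intro finsum_cong') (auto simp del: atMost_0 simp: finsum_0)
  finally show ?case .
next
  case (Suc n)
  have "(\<Oplus>i\<in>{..Suc n}. \<Oplus>j\<in>{..m}. f i j)
      = (\<Oplus>j\<in>{..m}. f (Suc n) j) \<oplus> (\<Oplus>j\<in>{..m}. \<Oplus>i\<in>{..n}. f i j)"
    using Suc by (subst finsum_Suc) (auto simp: Pi_def)
  also have "\<dots> = (\<Oplus>j\<in>{..m}. f (Suc n) j \<oplus> (\<Oplus>i\<in>{..n}. f i j))"
    using Suc(2) by (subst finsum_addf) (auto simp: Pi_def)
  also have "\<dots> = (\<Oplus>j\<in>{..m}. \<Oplus>i\<in>{..Suc n}. f i j)"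
    using Suc(2) by (intro finsum_cong') (auto simp: finsum_Suc Pi_def)
  finally show ?case .
qed

end

context domain
begin

text \<open>The case \<open>w = t\<close>, \<open>d = 1\<close> of \<open>has_degree_eval\<close>.
  It allows leading zeros, which occur in lists built from arbitrary sums.\<close>

lemma transcendental_eval_zero:
  assumes "subring K R" "t \<in> carrier R" "(transcendental over K) t" "set p \<subseteq> K" "eval p t = \<zero>"
  shows "set p \<subseteq> {\<zero>}"
  using has_degree_eval[OF assms(1,2) has_degree_self[OF assms(1,2)] _ assms(4)]
    has_degree_nonzero[OF assms(3)] assms(5) by auto

text \<open>The list is left unnormalised, so that every \<open>b i\<close> occurs in it; once its
  entries are known to vanish, so does each \<open>b i\<close>.\<close>

lemma finsum_eq_eval:
  assumes "subring K R" "x \<in> carrier R" "\<And>i. i \<le> n \<Longrightarrow> b i \<in> K"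
  obtains p where "set p \<subseteq> K" "eval p x = (\<Oplus>i\<in>{..n::nat}. b i \<otimes> x [^] i)"
    "\<And>i. i \<le> n \<Longrightarrow> b i \<in> set p"
proof -
  let ?p = "map b (rev [0..<Suc n])"
  have KR: "K \<subseteq> carrier R" using subringE(1)[OF assms(1)] .
  have co: "coeff ?p i = b i" if "i \<le> n" for i
    using that coeff_nth[of i ?p] by (simp add: rev_nth del: upt_Suc)
  have p: "set ?p \<subseteq> K" using assms(3) by auto
  have "eval ?p x = (\<Oplus>i\<in>{..n}. coeff ?p i \<otimes> x [^] i)"
    using eval_eq_finsum[of x ?p n] p KR assms(2) by (simp del: upt_Suc)
  also have "\<dots> = (\<Oplus>i\<in>{..n}. b i \<otimes> x [^] i)"
    using co assms(2,3) KR by (intro finsum_cong') (auto simp del: upt_Suc)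
  finally show ?thesis by (rule that[of ?p, OF p]) (auto simp del: upt_Suc)
qed

end

section \<open>Algebraic independence of a pair as iterated transcendence\<close>

context field
begin

text \<open>A relation for \<open>x\<close> over k(y) can be multiplied by a common denominator. Its
  coefficients then lie in k[y], and expanding them gives a bivariate relation over
  \<open>k\<close>.\<close>

lemma alg_independent2_imp_transcendental:
  assumes "subfield k R" "x \<in> carrier R" "y \<in> carrier R" "alg_independent2 R k x y"
  shows "(transcendental over (generate_field R (insert y k))) x"
proof (rule ccontr)
  let ?K = "generate_field R (insert y k)" and ?E = "simple_extension k y"
  assume neg: "\<not> (transcendental over ?K) x"
  have k: "subring k R" and kR: "k \<subseteq> carrier R" using subfieldE[OF assms(1)] by auto
  have K: "subfield ?K R" using generate_field_is_subfield kR assms(3) by auto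
  obtain p where p: "p \<in> carrier (?K[X])" "p \<noteq> []" "eval p x = \<zero>"
    using algebraicE[OF subfieldE(1)[OF K] assms(2)] neg unfolding over_def by blast
  have pK: "set p \<subseteq> ?K" and pol: "polynomial ?K p"
    using p(1) polynomial_incl by (auto simp: univ_poly_carrier[symmetric])
  have pc: "set p \<subseteq> carrier R" using pK subfieldE(3)[OF K] by auto
  obtain h where h: "h \<in> ?E" "h \<noteq> \<zero>" "(\<lambda>a. h \<otimes> a) ` set p \<subseteq> ?E"
    using generate_field_common_denominator[OF k assms(3) pK] by blast
  have hc: "h \<in> carrier R" using h(1) simple_extension_in_carrier[OF kR assms(3)] by auto
  let ?q = "map (\<lambda>a. h \<otimes> a) p"
  have qc: "set ?q \<subseteq> carrier R" using hc pc by auto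
  have eq: "eval ?q x = \<zero>" using eval_map_mult[OF hc assms(2) pc] p(3) hc by simp
  have "coeff ?q i \<in> ?E" for i
  proof -
    have "coeff ?q i \<in> set ?q \<union> {\<zero>}" using coeff_img(3)[of ?q] by blast
    thus ?thesis using h(3) by auto
  qed
  then have "\<forall>i. \<exists>A. A \<in> carrier (k[X]) \<and> coeff ?q i = eval A y"
    using simple_extension_as_eval_img[OF kR assms(3)] by blast
  from choice[OF this] obtain A
    where A: "\<And>i. A i \<in> carrier (k[X])" "\<And>i. coeff ?q i = eval (A i) y" by blast
  have Ak: "set (A i) \<subseteq> k" for i
    using A(1)[of i] polynomial_incl by (simp add: univ_poly_carrier [symmetric])
  \<comment> \<open>\<open>alg_independent2\<close> has one bound for both variables, so
    \<open>n\<close> dominates the length in \<open>x\<close> and all lengths in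
    \<open>y\<close>.\<close>
  define n where "n = length p + (\<Sum>i<length p. length (A i))"
  have nA: "length (A i) \<le> Suc n" if "i < length p" for i
    using member_le_sum[of i "{..<length p}" "\<lambda>i. length (A i)"] that unfolding n_def by simp
  \<comment> \<open>For \<open>i\<close> beyond the length of \<open>p\<close>, the chosen
    \<open>A i\<close> is some polynomial vanishing at \<open>y\<close>, of uncontrolled length; the
    default zero replaces it.\<close>
  define c where "c i j = (if i < length p then coeff (A i) j else \<zero>)" for i j
  have ck: "c i j \<in> k" for i j
  proof -
    have "coeff (A i) j \<in> set (A i) \<union> {\<zero>}" using coeff_img(3)[of "A i"] by blast
    thus ?thesis using Ak[of i] subringE(2)[OF k] unfolding c_def by auto
  qed
  have cc: "c i j \<in> carrier R" for i j using ck kR by blast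
  have inner: "(\<Oplus>j\<in>{..n}. c i j \<otimes> y [^] j) = coeff ?q i" for i
  proof (cases "i < length p")
    case True
    then show ?thesis
      using eval_eq_finsum[OF assms(3), of "A i" n] Ak[of i] kR nA A(2) unfolding c_def by auto
  next
    case False
    then have "coeff ?q i = \<zero>" using coeff_length[of ?q i] by simp
    then show ?thesis using False assms(3) unfolding c_def by (auto intro!: add.finprod_one_eqI)
  qed
  have "(\<Oplus>i\<in>{..n}. \<Oplus>j\<in>{..n}. c i j \<otimes> x [^] i \<otimes> y [^] j) = (\<Oplus>i\<in>{..n}. coeff ?q i \<otimes> x [^] i)"
  proof (intro finsum_cong' refl)
    show "(\<lambda>i. coeff ?q i \<otimes> x [^] i) \<in> {..n} \<rightarrow> carrier R" using qc assms(2) by auto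
    fix i
    have "(\<Oplus>j\<in>{..n}. c i j \<otimes> x [^] i \<otimes> y [^] j) = (\<Oplus>j\<in>{..n}. (c i j \<otimes> y [^] j) \<otimes> x [^] i)"
      using cc assms(2,3) by (intro finsum_cong') (auto simp: m_ac)
    also have "\<dots> = (\<Oplus>j\<in>{..n}. c i j \<otimes> y [^] j) \<otimes> x [^] i"
      using cc assms(2,3) by (intro finsum_ldistr[symmetric]) auto
    finally show "(\<Oplus>j\<in>{..n}. c i j \<otimes> x [^] i \<otimes> y [^] j) = coeff ?q i \<otimes> x [^] i"
      using inner by simp
  qed
  also have "\<dots> = \<zero>" using eval_eq_finsum[OF assms(2) qc, of n] eq unfolding n_def by simp
  finally have "c i j = \<zero>" if "i \<le> n" "j \<le> n" for i j
    using assms(4) ck that unfolding alg_independent2_def by blast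
  then have "coeff ?q i = \<zero>" if "i \<le> n" for i
    using inner[of i, symmetric] that assms(3) by (auto intro!: add.finprod_one_eqI)
  then have "set ?q \<subseteq> {\<zero>}"
    using coeff_img(1)[of ?q] unfolding n_def by auto
  then have "a = \<zero>" if "a \<in> set p" for a
    using that h(2) hc pc integral[of h a] by auto
  thus False using pol p(2) by (cases p) (auto simp: polynomial_def)
qed

text \<open>Grouping the sum by powers of \<open>x\<close> gives coefficients \<open>b i\<close> in
  k(y). They vanish as \<open>x\<close> is transcendental over k(y), and then each
  \<open>c i j\<close> vanishes as \<open>y\<close> is transcendental over \<open>k\<close>.\<close>

lemma alg_independent2I:
  assumes "subfield k R" "x \<in> carrier R" "y \<in> carrier R" "(transcendental over k) y"
    and "(transcendental over (generate_field R (insert y k))) x"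
  shows "alg_independent2 R k x y"
  unfolding alg_independent2_def
proof (intro allI impI)
  fix n and c :: "nat \<Rightarrow> nat \<Rightarrow> 'a" and i j
  assume c: "\<forall>i\<le>n. \<forall>j\<le>n. c i j \<in> k" and ij: "i \<le> n" "j \<le> n"
    and eq: "(\<Oplus>i\<in>{..n}. \<Oplus>j\<in>{..n}. c i j \<otimes> x [^] i \<otimes> y [^] j) = \<zero>"
  let ?K = "generate_field R (insert y k)"
  have k: "subring k R" and kR: "k \<subseteq> carrier R" using subfieldE[OF assms(1)] by auto
  have K: "subring ?K R" using subfieldE(1)[OF generate_field_is_subfield] kR assms(3) by auto
  have yK: "y \<in> ?K" and kK: "k \<subseteq> ?K" by (auto intro: generate_field.incl)
  define b where "b i = (\<Oplus>j\<in>{..n}. c i j \<otimes> y [^] j)" for i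
  have ex: "\<exists>p. set p \<subseteq> k \<and> eval p y = b i \<and> (\<forall>j\<le>n. c i j \<in> set p)" if "i \<le> n" for i
  proof -
    have "c i j \<in> k" if "j \<le> n" for j using c \<open>i \<le> n\<close> that by blast
    then show ?thesis unfolding b_def by (rule finsum_eq_eval[OF k assms(3), of n "c i"]) blast+
  qed
  have bK: "b i \<in> ?K" if "i \<le> n" for i
  proof -
    obtain p where p: "set p \<subseteq> k" "eval p y = b i" using ex[OF \<open>i \<le> n\<close>] by blast
    \<comment> \<open>Evaluating inside the subring \<open>?K\<close> shows that the value stays
      there.\<close>
    have "eval p y \<in> carrier (R\<lparr>carrier := ?K\<rparr>)"
      using ring.eval_in_carrier[OF subring_is_ring[OF K], of p y] eval_consistent[OF K] p kK yK by auto
    thus ?thesis using p by simp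
  qed
  have cc: "c i j \<in> carrier R" if "i \<le> n" "j \<le> n" for i j using c kR that by blast
  have "(\<Oplus>i\<in>{..n}. b i \<otimes> x [^] i) = (\<Oplus>i\<in>{..n}. \<Oplus>j\<in>{..n}. c i j \<otimes> x [^] i \<otimes> y [^] j)"
  proof (intro finsum_cong' refl)
    show "(\<lambda>i. \<Oplus>j\<in>{..n}. c i j \<otimes> x [^] i \<otimes> y [^] j) \<in> {..n} \<rightarrow> carrier R"
      using cc assms(2,3) by (auto intro!: finsum_closed)
    fix i assume i: "i \<in> {..n}"
    have "b i \<otimes> x [^] i = (\<Oplus>j\<in>{..n}. (c i j \<otimes> y [^] j) \<otimes> x [^] i)"
      using cc assms(2,3) i unfolding b_def by (intro finsum_ldistr) auto
    also have "\<dots> = (\<Oplus>j\<in>{..n}. c i j \<otimes> x [^] i \<otimes> y [^] j)"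
      using cc assms(2,3) i by (intro finsum_cong') (auto simp: m_ac)
    finally show "b i \<otimes> x [^] i = (\<Oplus>j\<in>{..n}. c i j \<otimes> x [^] i \<otimes> y [^] j)" .
  qed
  moreover obtain p where p: "set p \<subseteq> ?K" "eval p x = (\<Oplus>i\<in>{..n}. b i \<otimes> x [^] i)"
      "\<And>i. i \<le> n \<Longrightarrow> b i \<in> set p"
    using finsum_eq_eval[OF K assms(2), of n b] bK by blast
  ultimately have "set p \<subseteq> {\<zero>}"
    using transcendental_eval_zero[OF K assms(2,5) p(1)] eq by simp
  then have "b i = \<zero>" using p(3)[OF ij(1)] by blast
  moreover obtain q where q: "set q \<subseteq> k" "eval q y = b i" "\<forall>j\<le>n. c i j \<in> set q"
    using ex[OF ij(1)] by blast
  ultimately have "set q \<subseteq> {\<zero>}" using transcendental_eval_zero[OF k assms(3,4) q(1)] by simp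
  thus "c i j = \<zero>" using q(3) ij(2) by blast
qed

text \<open>Transposing the coefficient array and exchanging the two sums turns one relation into
  the other. The criterion by iterated transcendence treats the variables in a fixed order, so the
  symmetry is needed.\<close>

lemma alg_independent2_swap:
  assumes "k \<subseteq> carrier R" "x \<in> carrier R" "y \<in> carrier R" "alg_independent2 R k x y"
  shows "alg_independent2 R k y x"
  unfolding alg_independent2_def
proof (rule allI, rule allI, rule impI, rule impI)
  fix n and c :: "nat \<Rightarrow> nat \<Rightarrow> 'a"
  assume c: "\<forall>i\<le>n. \<forall>j\<le>n. c i j \<in> k"
    and eq: "(\<Oplus>i\<in>{..n}. \<Oplus>j\<in>{..n}. c i j \<otimes> y [^] i \<otimes> x [^] j) = \<zero>"
  have cc: "c i j \<in> carrier R" if "i \<le> n" "j \<le> n" for i j using c assms(1) that by blast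
  have "(\<Oplus>i\<in>{..n}. \<Oplus>j\<in>{..n}. c j i \<otimes> x [^] i \<otimes> y [^] j)
      = (\<Oplus>j\<in>{..n}. \<Oplus>i\<in>{..n}. c j i \<otimes> x [^] i \<otimes> y [^] j)"
    using cc assms(2,3) by (intro finsum_swap) auto
  also have "\<dots> = (\<Oplus>j\<in>{..n}. \<Oplus>i\<in>{..n}. c j i \<otimes> y [^] j \<otimes> x [^] i)"
  proof (intro finsum_cong' refl)
    show "(\<lambda>j. \<Oplus>i\<in>{..n}. c j i \<otimes> y [^] j \<otimes> x [^] i) \<in> {..n} \<rightarrow> carrier R"
      using cc assms(2,3) by (auto intro!: finsum_closed)
  qed (use cc assms(2,3) in \<open>auto intro!: finsum_cong' simp: m_ac\<close>)
  finally have "(\<Oplus>i\<in>{..n}. \<Oplus>j\<in>{..n}. c j i \<otimes> x [^] i \<otimes> y [^] j) = \<zero>" using eq by simp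
  thus "\<forall>i\<le>n. \<forall>j\<le>n. c i j = \<zero>"
    using assms(4)[unfolded alg_independent2_def, rule_format, of n "\<lambda>i j. c j i"] c by blast
qed

text \<open>Over k(y) the sum x + y has degree 1 in \<open>x\<close>, so it is transcendental there
  and the pair x + y, y is independent. Swapping this pair makes \<open>y\<close> transcendental
  over k(x + y).\<close>

lemma transcendental_over_sum:
  assumes "subfield k R" "x \<in> carrier R" "y \<in> carrier R" "alg_independent2 R k x y"
  shows "(transcendental over (generate_field R (insert (x \<oplus> y) k))) y"
proof -
  let ?K = "generate_field R (insert y k)"
  have kR: "k \<subseteq> carrier R" using subfieldE[OF assms(1)] by auto
  have K: "subring ?K R" using subfieldE(1)[OF generate_field_is_subfield] kR assms(3) by auto
  have yK: "y \<in> ?K" by (auto intro: generate_field.incl)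
  have ty: "(transcendental over k) y"
    using alg_independent2_imp_transcendental[OF assms(1,3,2) alg_independent2_swap[OF kR assms(2-4)]]
      transcendental_mono[of k "generate_field R (insert x k)" y] by (auto intro: generate_field.incl)
  have "y \<noteq> \<zero>" using ty eval_transcendental[of k y "[\<one>, \<zero>]"] subringE(2,3)[OF subfieldE(1)[OF assms(1)]] 
    by (auto simp: univ_poly_carrier [symmetric] polynomial_def)
  then have "has_degree ?K x (max 1 0) (x \<oplus> y)"
    using has_degree_add[OF K assms(2) has_degree_self[OF K assms(2)] has_degree_const[OF K assms(2) yK]]
    by simp
  then have "(transcendental over ?K) (x \<oplus> y)"
    using transcendental_if_has_degree[OF K assms(2) alg_independent2_imp_transcendental[OF assms]] by simp
  then have "alg_independent2 R k (x \<oplus> y) y"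
    using alg_independent2I[OF assms(1) _ assms(3) ty] assms(2,3) by simp
  then show ?thesis
    using alg_independent2_imp_transcendental[OF assms(1,3)] alg_independent2_swap[OF kR] assms(2,3) by simp
qed

end

section \<open>Artin--Schreier elements in characteristic two\<close>

lemma (in ring) subring_nat_pow:
  assumes "subring M R" "a \<in> M"
  shows "a [^] (n::nat) \<in> M"
  using subringE(3,6)[OF assms(1)] assms(2) by (induct n) auto

locale field_char_two = field +
  assumes one_add_one: "\<one> \<oplus> \<one> = \<zero>"
begin

lemma add_self [simp]: "a \<in> carrier R \<Longrightarrow> a \<oplus> a = \<zero>"
  using l_distr[of \<one> \<one> a] one_add_one by simp

lemma add_self_left [simp]: "a \<in> carrier R \<Longrightarrow> b \<in> carrier R \<Longrightarrow> a \<oplus> (a \<oplus> b) = b"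
  by (simp add: a_assoc[symmetric])

lemma frobenius_add:
  assumes "a \<in> carrier R" "b \<in> carrier R"
  shows "(a \<oplus> b) [^] (2 ^ j :: nat) = a [^] (2 ^ j :: nat) \<oplus> b [^] (2 ^ j :: nat)"
proof (induct j)
  case 0
  show ?case using assms by simp
next
  case (Suc j)
  have sq: "c [^] (2 ^ Suc j :: nat) = c [^] (2 ^ j :: nat) \<otimes> c [^] (2 ^ j :: nat)"
    if "c \<in> carrier R" for c
    using that by (simp add: nat_pow_mult mult_2)
  have "(c \<oplus> d) \<otimes> (c \<oplus> d) = c \<otimes> c \<oplus> d \<otimes> d" if "c \<in> carrier R" "d \<in> carrier R" for c d
    using that m_comm[of d c] by (simp add: l_distr r_distr a_assoc)
  then show ?case using assms Suc sq by simp
qed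

text \<open>The \<open>A\<^sub>j\<close> of the overview: the j-th Frobenius power minus the
  identity, applied to \<open>t\<close>, with the sign dropped in characteristic two.\<close>

definition artin_schreier :: "nat \<Rightarrow> 'a \<Rightarrow> 'a"
  where "artin_schreier j t = t [^] (2 ^ j :: nat) \<oplus> t"

lemma artin_schreier_closed [simp]: "t \<in> carrier R \<Longrightarrow> artin_schreier j t \<in> carrier R"
  by (simp add: artin_schreier_def)

text \<open>On the right the term t^(2^j) occurs twice and cancels.\<close>

lemma artin_schreier_add:
  assumes "t \<in> carrier R"
  shows "artin_schreier (i + j) t = artin_schreier i t [^] (2 ^ j :: nat) \<oplus> artin_schreier j t"
  using assms
  by (simp add: artin_schreier_def frobenius_add nat_pow_pow power_add a_assoc)

lemma artin_schreier_mult_mem: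
  assumes "subring M R" "t \<in> carrier R" "artin_schreier i t \<in> M"
  shows "artin_schreier (i * n) t \<in> M"
proof (induct n)
  case 0
  show ?case using assms(2) subringE(2)[OF assms(1)] by (simp add: artin_schreier_def)
next
  case (Suc n)
  show ?case
    using artin_schreier_add[OF assms(2), of i "i * n"] Suc subring_nat_pow[OF assms(1,3)]
      subringE(7)[OF assms(1)] by simp
qed

text \<open>Euclid's algorithm on the indices: writing \<open>m\<close> as a multiple of
  \<open>n\<close> plus a remainder, the addition formula expresses the element of index
  \<open>m mod n\<close> through those of index \<open>m\<close> and \<open>n\<close>.\<close>

lemma artin_schreier_gcd_mem:
  assumes "subring M R" "t \<in> carrier R"
  shows "artin_schreier r t \<in> M \<Longrightarrow> artin_schreier s t \<in> M \<Longrightarrow> artin_schreier (gcd r s) t \<in> M"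
proof (induct r s rule: gcd_nat_induct)
  case (base m)
  then show ?case by simp
next
  case (step m n)
  let ?a = "artin_schreier (n * (m div n)) t [^] (2 ^ (m mod n) :: nat)"
  have a: "?a \<in> M"
    using subring_nat_pow[OF assms(1)] artin_schreier_mult_mem[OF assms step(4)] .
  have "artin_schreier m t = ?a \<oplus> artin_schreier (m mod n) t"
    using artin_schreier_add[OF assms(2), of "n * (m div n)" "m mod n"] by simp
  then have "artin_schreier (m mod n) t = ?a \<oplus> artin_schreier m t"
    using assms(2) by simp
  then have "artin_schreier (m mod n) t \<in> M"
    using a step(3) subringE(7)[OF assms(1)] by simp
  then have "artin_schreier (gcd n (m mod n)) t \<in> M" using step by simp
  then show ?case using step(1) by (simp add: gcd_red_nat[of m n])
qed

lemma has_degree_artin_schreier: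
  assumes "subring K R" "t \<in> carrier R" "j \<ge> 1"
  shows "has_degree K t (2 ^ j) (artin_schreier j t)"
proof -
  \<comment> \<open>For \<open>j = 0\<close> the two terms would cancel; \<open>j \<ge> 1\<close>
    makes their degrees distinct.\<close>
  have "(1::nat) < 2 ^ j" using assms(3) by (intro one_less_power) auto
  then show ?thesis
    using has_degree_add[OF assms(1,2) has_degree_pow[OF assms(1,2) has_degree_self[OF assms(1,2)], of "2 ^ j"]
        has_degree_self[OF assms(1,2)]] assms(3) unfolding artin_schreier_def by (simp add: max_def)
qed

text \<open>The field is S + St with t^2 = t + u and u in \<open>S\<close>, and t + 1 satisfies the
  same quadratic equation. Hence bt + a to b(t + 1) + a is an automorphism, and a fixed point has b
  = 0.\<close>

lemma artin_schreier_automorphism: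
  assumes S: "subfield S R" and t: "t \<in> carrier R" "t \<notin> S" "artin_schreier 1 t \<in> S"
    and span: "\<And>f. f \<in> carrier R \<Longrightarrow> \<exists>b \<in> S. \<exists>a \<in> S. f = b \<otimes> t \<oplus> a"
  obtains \<sigma> where "\<sigma> \<in> ring_iso R R" "\<And>a. a \<in> S \<Longrightarrow> \<sigma> a = a" "\<sigma> t = t \<oplus> \<one>"
    "\<And>f. f \<in> carrier R \<Longrightarrow> \<sigma> f = f \<Longrightarrow> f \<in> S"
proof -
  note Ss = subringE[OF subfieldE(1)[OF S]]
  have c: "a \<in> S \<Longrightarrow> a \<in> carrier R" for a using Ss(1) by auto
  have "\<forall>f. \<exists>b. f \<in> carrier R \<longrightarrow> b \<in> S \<and> (\<exists>a \<in> S. f = b \<otimes> t \<oplus> a)" using span by blast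
  from choice[OF this] obtain B where
    B: "\<And>f. f \<in> carrier R \<Longrightarrow> B f \<in> S" "\<And>f. f \<in> carrier R \<Longrightarrow> \<exists>a \<in> S. f = B f \<otimes> t \<oplus> a"
    by blast
  \<comment> \<open>The coefficient of \<open>t\<close> is unique: two different ones would put a
    nonzero \<open>S\<close>-multiple of \<open>t\<close>, and hence \<open>t\<close>, into
    \<open>S\<close>.\<close>
  have B_eq: "B (b \<otimes> t \<oplus> a) = b" if ba: "b \<in> S" "a \<in> S" for a b
  proof (rule ccontr)
    let ?f = "b \<otimes> t \<oplus> a"
    assume ne: "B ?f \<noteq> b"
    have f: "?f \<in> carrier R" using ba c t by simp
    obtain a' where a': "a' \<in> S" "?f = B ?f \<otimes> t \<oplus> a'" using B(2)[OF f] by blast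
    let ?d = "B ?f"
    note cc = c[OF ba(1)] c[OF ba(2)] c[OF a'(1)] c[OF B(1)[OF f]] t(1)
    have "(?d \<oplus> b) \<otimes> t = (?d \<otimes> t \<oplus> a') \<oplus> a' \<oplus> b \<otimes> t" using cc by (simp add: l_distr a_ac)
    also have "\<dots> = ?f \<oplus> a' \<oplus> b \<otimes> t" using a'(2) by simp
    also have "\<dots> = a \<oplus> a'" using cc by (simp add: a_ac)
    finally have "(?d \<oplus> b) \<otimes> t \<in> S" using Ss(7) ba a' by simp
    moreover have "?d \<oplus> b \<noteq> \<zero>"
    proof
      assume "?d \<oplus> b = \<zero>"
      then have "?d \<oplus> b \<oplus> b = b" using cc by simp
      then show False using ne cc by (simp add: a_assoc)
    qed
    ultimately have "t \<in> S"
      using subfield_m_inv_simprule[OF S, of "?d \<oplus> b" t] Ss(7) B(1)[OF f] ba t by simp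
    then show False using t by simp
  qed
  \<comment> \<open>Replacing \<open>t\<close> by t + 1 in bt + a adds exactly the coefficient
    b.\<close>
  define \<sigma> where "\<sigma> f = f \<oplus> B f" for f
  have Bc: "B f \<in> carrier R" if "f \<in> carrier R" for f using B(1)[OF that] c by blast
  have sc: "\<sigma> f \<in> carrier R" if "f \<in> carrier R" for f using that Bc unfolding \<sigma>_def by simp
  have B_S: "B a = \<zero>" if "a \<in> S" for a using B_eq[OF Ss(2) that] c[OF that] t by simp
  have s_S: "\<sigma> a = a" if "a \<in> S" for a using B_S[OF that] c[OF that] unfolding \<sigma>_def by simp
  have s_t: "\<sigma> t = t \<oplus> \<one>" using B_eq[OF Ss(3,2)] t unfolding \<sigma>_def by simp
  have B_add: "B (f \<oplus> g) = B f \<oplus> B g" if fg: "f \<in> carrier R" "g \<in> carrier R" for f g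
  proof -
    obtain a a' where a: "a \<in> S" "f = B f \<otimes> t \<oplus> a" and a': "a' \<in> S" "g = B g \<otimes> t \<oplus> a'"
      using B(2) fg by meson
    note cc = c[OF a(1)] c[OF a'(1)] Bc[OF fg(1)] Bc[OF fg(2)] t(1)
    have "f \<oplus> g = (B f \<otimes> t \<oplus> a) \<oplus> (B g \<otimes> t \<oplus> a')" using a a' by simp
    also have "\<dots> = (B f \<oplus> B g) \<otimes> t \<oplus> (a \<oplus> a')" using cc by algebra
    finally show ?thesis using B_eq B(1) fg a a' Ss(7) by simp
  qed
  have s_add: "\<sigma> (f \<oplus> g) = \<sigma> f \<oplus> \<sigma> g" if "f \<in> carrier R" "g \<in> carrier R" for f g
    using that Bc B_add unfolding \<sigma>_def by (simp add: a_ac)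
  have s_mult: "\<sigma> (f \<otimes> g) = \<sigma> f \<otimes> \<sigma> g" if fg: "f \<in> carrier R" "g \<in> carrier R" for f g
  proof -
    obtain a a' where a: "a \<in> S" "f = B f \<otimes> t \<oplus> a" and a': "a' \<in> S" "g = B g \<otimes> t \<oplus> a'"
      using B(2) fg by meson
    let ?b = "B f" and ?d = "B g" and ?u = "artin_schreier 1 t"
    note cc = c[OF a(1)] c[OF a'(1)] Bc[OF fg(1)] Bc[OF fg(2)] t(1)
    have bS: "?b \<in> S" "?d \<in> S" using B(1) fg by auto
    have tt: "t \<otimes> t = t \<oplus> ?u" using t(1) by (simp add: artin_schreier_def a_ac numeral_2_eq_2)
    have "f \<otimes> g = (?b \<otimes> t \<oplus> a) \<otimes> (?d \<otimes> t \<oplus> a')" using a a' by simp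
    also have "\<dots> = ?b \<otimes> ?d \<otimes> (t \<otimes> t) \<oplus> (?b \<otimes> a' \<oplus> a \<otimes> ?d) \<otimes> t \<oplus> a \<otimes> a'" using cc by algebra
    also have "\<dots> = (?b \<otimes> ?d \<oplus> ?b \<otimes> a' \<oplus> a \<otimes> ?d) \<otimes> t \<oplus> (?b \<otimes> ?d \<otimes> ?u \<oplus> a \<otimes> a')"
      unfolding tt using cc artin_schreier_closed[OF t(1), of 1] by algebra
    finally have "B (f \<otimes> g) = ?b \<otimes> ?d \<oplus> ?b \<otimes> a' \<oplus> a \<otimes> ?d"
      using B_eq bS a a' t(3) Ss(6,7) by simp
    then have "\<sigma> (f \<otimes> g) = f \<otimes> g \<oplus> (?b \<otimes> ?d \<oplus> ?b \<otimes> a' \<oplus> a \<otimes> ?d)" unfolding \<sigma>_def by simp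
    \<comment> \<open>The term bdt is inserted twice, which changes nothing; it completes a' to
      \<open>g\<close> and \<open>a\<close> to \<open>f\<close>, so that the whole factors as (f +
      b)(g + d).\<close>
    also have "\<dots> = f \<otimes> g \<oplus> (?b \<otimes> ?d \<oplus> ?b \<otimes> (?d \<otimes> t \<oplus> a') \<oplus> (?b \<otimes> t \<oplus> a) \<otimes> ?d)"
      using cc fg by (simp add: l_distr r_distr a_ac m_ac)
    also have "\<dots> = f \<otimes> g \<oplus> (?b \<otimes> ?d \<oplus> ?b \<otimes> g \<oplus> f \<otimes> ?d)" using a(2) a'(2) by simp
    also have "\<dots> = \<sigma> f \<otimes> \<sigma> g"
      using cc fg unfolding \<sigma>_def by (simp add: l_distr r_distr a_ac)
    finally show ?thesis .
  qed
  have s_s: "\<sigma> (\<sigma> f) = f" if f: "f \<in> carrier R" for f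
  proof -
    have "\<sigma> (\<sigma> f) = \<sigma> f \<oplus> \<sigma> (B f)" using s_add[OF f Bc[OF f]] \<sigma>_def by simp
    also have "\<dots> = f" using s_S[OF B(1)[OF f]] Bc[OF f] f unfolding \<sigma>_def by (simp add: a_ac)
    finally show ?thesis .
  qed
  \<comment> \<open>\<open>\<sigma>\<close> is an involution, hence its own inverse.\<close>
  have "bij_betw \<sigma> (carrier R) (carrier R)"
    using sc s_s by (intro bij_betw_byWitness[of _ \<sigma>]) auto
  then have "\<sigma> \<in> ring_iso R R"
    unfolding ring_iso_def using sc s_add s_mult s_S[OF Ss(3)] by (auto intro!: ring_hom_memI)
  moreover have "f \<in> S" if f: "f \<in> carrier R" "\<sigma> f = f" for f
  proof -
    have "f \<oplus> (f \<oplus> B f) = f \<oplus> f" using f unfolding \<sigma>_def by simp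
    then have "B f = \<zero>" using f Bc[OF f(1)] by simp
    then show ?thesis using B(2)[OF f(1)] c t by auto
  qed
  ultimately show ?thesis using that s_S s_t by blast
qed

end

lemma (in field) fixed_points_subfield:
  assumes "h \<in> ring_hom R R"
  shows "subfield {f \<in> carrier R. h f = f} R"
proof (rule subfieldI')
  interpret ring_hom_ring R R h using assms ring_axioms by (intro ring_hom_ringI2)
  show "subring {f \<in> carrier R. h f = f} R" by (rule subringI) auto
  fix f assume "f \<in> {f \<in> carrier R. h f = f} - {\<zero>}"
  then have f: "f \<in> carrier R" "h f = f" "f \<in> Units R" using field_Units by auto
  then have "f \<otimes> h (inv f) = h (f \<otimes> inv f)"
    using hom_mult[OF f(1) Units_inv_closed[OF f(3)]] f(2) by (simp only:)
  also have "\<dots> = \<one>" using f(3) by simp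
  finally have "h (inv f) = inv f" using f by (intro comm_inv_char[symmetric]) auto
  then show "inv f \<in> {f \<in> carrier R. h f = f}" using f by auto
qed

section \<open>Power sums and symmetric functions in terms of e and t\<close>

context field_char_two
begin

text \<open>With x = et + e and y = et, Frobenius splits the 2^j-th powers; the product of the top
  terms of x^(2^j) and x equals y^(2^j+1) and cancels against it.\<close>

lemma power_sum2_artin_schreier:
  assumes "e \<in> carrier R" "t \<in> carrier R"
  shows "power_sum2 R (e \<otimes> t \<oplus> e) (e \<otimes> t) (2 ^ j + 1)
    = e [^] (2 ^ j + 1 :: nat) \<otimes> (artin_schreier j t \<oplus> \<one>)"
proof -
  let ?E = "e [^] (2 ^ j :: nat)" and ?T = "t [^] (2 ^ j :: nat)"
  have c: "?E \<in> carrier R" "?T \<in> carrier R" using assms by auto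
  have "power_sum2 R (e \<otimes> t \<oplus> e) (e \<otimes> t) (2 ^ j + 1)
    = (?E \<otimes> ?T \<oplus> ?E) \<otimes> (e \<otimes> t \<oplus> e) \<oplus> ?E \<otimes> ?T \<otimes> (e \<otimes> t)"
    using assms by (simp add: power_sum2_def frobenius_add nat_pow_distrib)
  also have "\<dots> = ?E \<otimes> e \<otimes> (?T \<oplus> t \<oplus> \<one>) \<oplus> (?E \<otimes> ?T \<otimes> (e \<otimes> t) \<oplus> ?E \<otimes> ?T \<otimes> (e \<otimes> t))"
    using c assms by algebra
  also have "\<dots> = e [^] (2 ^ j + 1 :: nat) \<otimes> (artin_schreier j t \<oplus> \<one>)"
    using c assms by (simp add: artin_schreier_def)
  finally show ?thesis .
qed

text \<open>The factor e^(2^j+1) is a nonzero element of \<open>M\<close>, so it can be divided out,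
  and the summand 1 can be removed.\<close>

lemma power_sum2_mem_iff:
  assumes M: "subfield M R" and e: "e \<in> M" "e \<noteq> \<zero>" and t: "t \<in> carrier R"
  shows "power_sum2 R (e \<otimes> t \<oplus> e) (e \<otimes> t) (2 ^ j + 1) \<in> M \<longleftrightarrow> artin_schreier j t \<in> M"
proof -
  let ?A = "artin_schreier j t" and ?E = "e [^] (2 ^ j + 1 :: nat)"
  note Ms = subringE[OF subfieldE(1)[OF M]]
  have ec: "e \<in> carrier R" using e(1) Ms(1) by auto
  have E: "?E \<in> M" by (rule subring_nat_pow[OF subfieldE(1)[OF M] e(1)])
  have "e \<in> Units R" using ec e(2) field_Units by simp
  then have "?E \<in> Units R" by (rule Units_pow_closed)
  then have E0: "?E \<noteq> \<zero>" using field_Units by simp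
  have Ac: "?A \<oplus> \<one> \<in> carrier R" using t by simp
  have "?A \<in> M" if "?E \<otimes> (?A \<oplus> \<one>) \<in> M"
  proof -
    have "?A \<oplus> \<one> \<in> M" using subfield_m_inv_simprule[OF M, of ?E "?A \<oplus> \<one>"] E E0 Ac that by blast
    then have "(?A \<oplus> \<one>) \<oplus> \<one> \<in> M" using Ms(3,7) by blast
    then show ?thesis using t by (simp add: a_assoc)
  qed
  moreover have "?E \<otimes> (?A \<oplus> \<one>) \<in> M" if "?A \<in> M" using that E Ms(3,6,7) by blast
  ultimately show ?thesis using power_sum2_artin_schreier[OF ec t, of j] by metis
qed

text \<open>One inclusion needs a single exchange automorphism with no fixed points outside
  \<open>?S\<close>. For the other, every exchange automorphism fixes x + y = e and xy = e^2 (t^2 +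
  t), hence all generators of \<open>?S\<close>.\<close>

lemma symmetric_functions_eq:
  assumes k: "subfield k R" and e: "e \<in> carrier R" "e \<noteq> \<zero>" and t: "t \<in> carrier R"
    and trans: "(transcendental over (generate_field R (insert e k))) t"
    and gen: "carrier R = generate_field R (insert t (generate_field R (insert e k)))"
  shows "symmetric_functions R k (e \<otimes> t \<oplus> e) (e \<otimes> t)
    = generate_field R (insert (artin_schreier 1 t) (generate_field R (insert e k)))"
    (is "?Sym = ?S")
proof -
  let ?K = "generate_field R (insert e k)" and ?u = "artin_schreier 1 t"
  let ?x = "e \<otimes> t \<oplus> e" and ?y = "e \<otimes> t"
  have kR: "k \<subseteq> carrier R" using subfieldE[OF k] by auto
  have K: "subfield ?K R" using generate_field_is_subfield kR e by auto
  note KR = subfieldE(3)[OF K]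
  have deg: "has_degree ?K t 2 ?u"
    using has_degree_artin_schreier[OF subfieldE(1)[OF K] t, of 1] by simp
  note D = degree_over_polynomial[OF K t trans deg _ gen]
  have S: "subfield ?S R" using D(1) by simp
  note Ss = subringE[OF subfieldE(1)[OF S]]
  have KS: "?K \<subseteq> ?S" and uS: "?u \<in> ?S" by (auto intro: generate_field.incl)
  have kS: "k \<subseteq> ?S" and eS: "e \<in> ?S" using KS by (auto intro: generate_field.incl)
  \<comment> \<open>Otherwise X - t would be a polynomial over \<open>?S\<close> of degree 1 < 2
    with root \<open>t\<close>.\<close>
  have "t \<notin> ?S"
  proof
    assume "t \<in> ?S"
    then have "polynomial ?S [\<one>, \<ominus> t]" using Ss(3,5) by (auto simp: polynomial_def)
    moreover have "eval [\<one>, \<ominus> t] t = \<zero>" using t by (simp add: r_neg)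
    ultimately show False
      using no_root_of_small_degree[OF subfieldE(1)[OF K] t trans deg, of "[\<one>, \<ominus> t]"] by simp
  qed
  moreover have "\<exists>b \<in> ?S. \<exists>a \<in> ?S. f = b \<otimes> t \<oplus> a" if "f \<in> carrier R" for f
  proof -
    \<comment> \<open>Degree 2 makes 1 and \<open>t\<close> span the field over \<open>?S\<close>,
      so each element is the value of a list of length at most 2.\<close>
    have "Span ?S (exp_base t 2) = carrier R"
      using Span_exp_base[OF S t] D(2-4) by simp
    then obtain p where p: "p \<in> carrier (?S[X])" "length p \<le> 2" "f = eval p t"
      using \<open>f \<in> carrier R\<close> unfolding Span_eq_eval_img[OF S t] by blast
    have pS: "set p \<subseteq> ?S" using p(1) polynomial_incl by (auto simp: univ_poly_carrier[symmetric])
    consider "p = []" | a where "p = [a]" | b a where "p = [b, a]"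
      using p(2) by (cases p; cases "tl p") auto
    then show ?thesis
    proof cases
      case 1
      then show ?thesis using p(3) Ss(2) t by (intro bexI[of _ \<zero>]) auto
    next
      case (2 a)
      then show ?thesis using p(3) pS Ss(1,2) t by (intro bexI[of _ \<zero>] bexI[of _ a]) auto
    next
      case (3 b a)
      then show ?thesis using p(3) pS Ss(1) t by (intro bexI[of _ b] bexI[of _ a]) auto
    qed
  qed
  ultimately obtain h where h: "h \<in> ring_iso R R" "\<And>a. a \<in> ?S \<Longrightarrow> h a = a" "h t = t \<oplus> \<one>"
    "\<And>f. f \<in> carrier R \<Longrightarrow> h f = f \<Longrightarrow> f \<in> ?S"
    using artin_schreier_automorphism[OF S t _ uS] by blast
  have hh: "h \<in> ring_hom R R" using h(1) unfolding ring_iso_def by simp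
  \<comment> \<open>The map fixes \<open>e\<close> and sends \<open>t\<close> to t + 1, so et goes
    to et + e, and back since e + e = 0.\<close>
  have hy: "h ?y = ?x"
    using ring_hom_mult[OF hh e(1) t] h(2)[OF eS] h(3) e t by (simp add: r_distr)
  have "h ?x = ?x \<oplus> e"
    using ring_hom_add[OF hh, of ?y e] hy h(2)[OF eS] e t by simp
  then have hx: "h ?x = ?y" using e t by (simp add: a_assoc)
  have "exchange_automorphism R k ?x ?y h"
    using h(1,2) kS hx hy unfolding exchange_automorphism_def by blast
  then have "?Sym \<subseteq> ?S" using h(4) unfolding symmetric_functions_def by blast
  moreover have "?S \<subseteq> ?Sym"
  proof -
    have "s f = f" if s: "exchange_automorphism R k ?x ?y s" and f: "f \<in> ?S" for s f
    proof -
      let ?M = "{f \<in> carrier R. s f = f}"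
      have sh: "s \<in> ring_hom R R" and sk: "\<forall>a\<in>k. s a = a" and sx: "s ?x = ?y" and sy: "s ?y = ?x"
        using s unfolding exchange_automorphism_def ring_iso_def by auto
      have M: "subfield ?M R" using fixed_points_subfield[OF sh] .
      have xy: "?x \<in> carrier R" "?y \<in> carrier R" using e t by auto
      have "?x \<oplus> ?y = ?y \<oplus> (?y \<oplus> e)" using e t by (simp add: a_ac)
      then have exy: "?x \<oplus> ?y = e" using e t by simp
      have "s (?x \<oplus> ?y) = ?y \<oplus> ?x" using ring_hom_add[OF sh xy] sx sy by simp
      then have eM: "e \<in> ?M" using exy e a_comm[OF xy] by simp
      have "s (?x \<otimes> ?y) = ?y \<otimes> ?x" using ring_hom_mult[OF sh xy] sx sy by simp
      then have "?x \<otimes> ?y \<in> ?M" using xy m_comm[OF xy] by simp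
      moreover have "?x \<otimes> ?y = (e \<otimes> e) \<otimes> ?u"
      proof -
        have "?x \<otimes> ?y = (e \<otimes> e) \<otimes> (t \<otimes> t \<oplus> t)" using e t by algebra
        then show ?thesis using t by (simp add: artin_schreier_def numeral_2_eq_2)
      qed
      moreover have "e \<otimes> e \<in> ?M - {\<zero>}"
        using subringE(6)[OF subfieldE(1)[OF M] eM eM] e integral[of e e] by auto
      ultimately have "?u \<in> ?M"
        using subfield_m_inv_simprule[OF M, of "e \<otimes> e" ?u] t by simp
      moreover have "?K \<subseteq> ?M"
        using eM sk kR e by (intro generate_field_min_subfield1[OF _ M]) auto
      ultimately have "?S \<subseteq> ?M"
        using KR t by (intro generate_field_min_subfield1[OF _ M]) auto
      then show ?thesis using f by blast
    qed
    then show ?thesis using Ss(1) unfolding symmetric_functions_def by blast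
  qed
  ultimately show ?thesis by blast
qed

end

section \<open>The degree of the symmetric functions by the tower law\<close>

theorem mainTheorem4:
  fixes F :: "('a, 'b) ring_scheme" and k :: "'a set" and x y :: 'a and r s m :: nat
  assumes "field F" and "subfield k F"
    and "has_characteristic (F\<lparr>carrier := k\<rparr>) 2"
    and "x \<in> carrier F" and "y \<in> carrier F"
    and "alg_independent2 F k x y"
    and "carrier F = generate_field F (k \<union> {x, y})"
    and "r > s" and "s \<ge> 1" and "m = gcd r s"
  shows "ring.dimension F (2 ^ (m - 1))
    (generate_field F
       (k \<union> {power_sum2 F x y (2 ^ r + 1), power_sum2 F x y (2 ^ s + 1), power_sum2 F x y 1}))
    (symmetric_functions F k x y)"
proof -
  interpret field F by fact
  \<comment> \<open>The characteristic is that of \<open>k\<close>, which shares its unit with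
    \<open>F\<close>; taking n = 2 gives 1 + 1 = 0 in \<open>F\<close>.\<close>
  have "add_pow (F\<lparr>carrier := k\<rparr>) (2::nat) \<one>\<^bsub>F\<lparr>carrier := k\<rparr>\<^esub> = \<zero>\<^bsub>F\<lparr>carrier := k\<rparr>\<^esub>"
    using assms(3)[unfolded has_characteristic_def, THEN spec, of 2] by simp
  then have "\<one>\<^bsub>F\<^esub> \<oplus>\<^bsub>F\<^esub> \<one>\<^bsub>F\<^esub> = \<zero>\<^bsub>F\<^esub>"
    by (simp add: add_pow_def nat_pow_def numeral_2_eq_2)
  then interpret field_char_two F by unfold_locales
  note k = assms(2) and x = assms(4) and y = assms(5)
  have kF: "k \<subseteq> carrier F" using subfieldE[OF k] by auto
  define e where "e = x \<oplus>\<^bsub>F\<^esub> y"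
  have e: "e \<in> carrier F" using x y unfolding e_def by simp
  define K where "K = generate_field F (insert e k)"
  have K: "subfield K F" using generate_field_is_subfield kF e unfolding K_def by auto
  note Kr = subfieldE(1)[OF K] and KF = subfieldE(3)[OF K]
  have eK: "e \<in> K" and kK: "k \<subseteq> K" unfolding K_def by (auto intro: generate_field.incl)
  have ty: "(transcendental over K) y"
    using transcendental_over_sum[OF k x y assms(6)] unfolding K_def e_def .
  \<comment> \<open>In characteristic two e = 0 would mean x = y, but \<open>x\<close> is
    transcendental over k(y).\<close>
  have e0: "e \<noteq> \<zero>\<^bsub>F\<^esub>"
  proof
    assume "e = \<zero>\<^bsub>F\<^esub>"
    then have "x \<oplus>\<^bsub>F\<^esub> y \<oplus>\<^bsub>F\<^esub> y = y" using y unfolding e_def by simp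
    then have "x = y" using x y by (simp add: a_assoc)
    have "(transcendental over (generate_field F (insert y k))) x"
      using alg_independent2_imp_transcendental[OF k x y assms(6)] .
    moreover have "(algebraic over (generate_field F (insert y k))) x"
      using algebraic_self[OF subfieldE(1)[OF generate_field_is_subfield], of "insert y k" x]
        kF y \<open>x = y\<close> by (auto intro: generate_field.incl)
    ultimately show False unfolding over_def by simp
  qed
  have eU: "e \<in> Units F" using e e0 field_Units by simp
  define t where "t = inv\<^bsub>F\<^esub> e \<otimes>\<^bsub>F\<^esub> y"
  have ie: "inv\<^bsub>F\<^esub> e \<in> K - {\<zero>\<^bsub>F\<^esub>}" using subfield_m_inv[OF K, of e] eK e0 by simp
  have t: "t \<in> carrier F" using eU y unfolding t_def by simp
  have y_eq: "y = e \<otimes>\<^bsub>F\<^esub> t" using eU e y unfolding t_def by (simp add: m_assoc[symmetric])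
  have x_eq: "x = e \<otimes>\<^bsub>F\<^esub> t \<oplus>\<^bsub>F\<^esub> e"
  proof -
    have "x = y \<oplus>\<^bsub>F\<^esub> e" using x y unfolding e_def by (simp add: a_ac)
    then show ?thesis using y_eq by simp
  qed
  \<comment> \<open>As 1/e is a nonzero constant of \<open>K\<close>, \<open>t\<close> has degree 1
    in \<open>y\<close> and inherits its transcendence.\<close>
  have "has_degree K y (0 + 1) t"
    using has_degree_mult[OF Kr y has_degree_const[OF Kr y, of "inv\<^bsub>F\<^esub> e"] has_degree_self[OF Kr y]] ie
    unfolding t_def by simp
  then have tt: "(transcendental over K) t"
    using transcendental_if_has_degree[OF Kr y ty] by simp
  have gen: "carrier F = generate_field F (insert t K)"
  proof -
    let ?G = "generate_field F (insert t K)"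
    have G: "subfield ?G F" using generate_field_is_subfield KF t by auto
    note Gs = subringE[OF subfieldE(1)[OF G]]
    have KG: "K \<subseteq> ?G" and tG: "t \<in> ?G" by (auto intro: generate_field.incl)
    then have "y \<in> ?G" "x \<in> ?G" unfolding y_eq x_eq using eK Gs(6,7) by (auto simp: subset_iff)
    then have "carrier F \<subseteq> ?G"
      unfolding assms(7) using KG kK kF x y by (intro generate_field_min_subfield1[OF _ G]) auto
    then show ?thesis using Gs(1) by blast
  qed
  define S where "S = generate_field F (insert (artin_schreier 1 t) K)"
  have Sym: "symmetric_functions F k x y = S"
    using symmetric_functions_eq[OF k e e0 t tt[unfolded K_def] gen[unfolded K_def]]
    unfolding S_def K_def x_eq[symmetric] unfolding y_eq[symmetric] .
  let ?L = "generate_field F (insert (artin_schreier m t) K)"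
  have m: "m \<ge> 1" using assms(8,9,10) by (simp add: Suc_leI)
  note DL = degree_over_polynomial[OF K t tt has_degree_artin_schreier[OF Kr t m] _ gen]
  \<comment> \<open>The index 1 gives the degree 2 of \<open>F\<close> over \<open>S\<close>, while
    index \<open>m\<close> gives 2^m over \<open>?L\<close>.\<close>
  note DS = degree_over_polynomial[OF K t tt has_degree_artin_schreier[OF Kr t order_refl[of 1]] _ gen]
  have L: "subfield ?L F" using DL(1) by simp
  have S: "subfield S F" using DS(1) unfolding S_def by simp
  have L_eq: "generate_field F
       (k \<union> {power_sum2 F x y (2 ^ r + 1), power_sum2 F x y (2 ^ s + 1), power_sum2 F x y 1}) = ?L"
    (is "?N = _")
  proof
    have N1: "power_sum2 F x y 1 = e" using x y by (simp add: power_sum2_def e_def)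
    have gens: "k \<union> {power_sum2 F x y (2 ^ r + 1), power_sum2 F x y (2 ^ s + 1), power_sum2 F x y 1}
        \<subseteq> carrier F"
      using kF x y by (auto simp: power_sum2_def)
    have N: "subfield ?N F" using generate_field_is_subfield[OF gens] .
    have iff: "power_sum2 F x y (2 ^ j + 1) \<in> M \<longleftrightarrow> artin_schreier j t \<in> M"
      if "subfield M F" "e \<in> M" for M j
      using power_sum2_mem_iff[OF that e0 t, of j] unfolding x_eq[symmetric] unfolding y_eq[symmetric] .
    have KL: "K \<subseteq> ?L" and mL: "artin_schreier m t \<in> ?L" by (auto intro: generate_field.incl)
    have mult: "artin_schreier j t \<in> ?L" if "m dvd j" for j
      using artin_schreier_mult_mem[OF subfieldE(1)[OF L] t mL] that by (auto elim: dvdE)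
    have "power_sum2 F x y (2 ^ j + 1) \<in> ?L" if "m dvd j" for j
      using iff[OF L] mult[OF that] eK KL by blast
    moreover have "m dvd r" "m dvd s" using assms(10) by auto
    ultimately show "?N \<subseteq> ?L"
      using KL kK eK N1 by (intro generate_field_min_subfield1[OF gens L]) auto
    have eN: "e \<in> ?N" and kN: "k \<subseteq> ?N" and rs: "power_sum2 F x y (2 ^ r + 1) \<in> ?N"
      "power_sum2 F x y (2 ^ s + 1) \<in> ?N"
      using N1 by (auto intro: generate_field.incl)
    \<comment> \<open>\<open>?N\<close> contains \<open>e\<close> and both power sums, so it
      contains the elements of index \<open>r\<close> and \<open>s\<close>, and by Euclid that of
      index \<open>m\<close>.\<close>
    have "artin_schreier m t \<in> ?N"
      using artin_schreier_gcd_mem[OF subfieldE(1)[OF N] t] iff[OF N eN] rs assms(10) by blast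
    moreover have "K \<subseteq> ?N"
      unfolding K_def using eN kN kF e by (intro generate_field_min_subfield1[OF _ N]) auto
    ultimately show "?L \<subseteq> ?N"
      using KF t by (intro generate_field_min_subfield1[OF _ N]) auto
  qed
  have LS: "?L \<subseteq> S"
  proof -
    have "artin_schreier 1 t \<in> S" unfolding S_def by (auto intro: generate_field.incl)
    then have "artin_schreier m t \<in> S"
      using artin_schreier_mult_mem[OF subfieldE(1)[OF S] t, of 1 m] by simp
    moreover have "K \<subseteq> S" unfolding S_def by (auto intro: generate_field.incl)
    ultimately show ?thesis using KF t by (intro generate_field_min_subfield1[OF _ S]) auto
  qed
  have dL: "dimension (2 ^ m) ?L (carrier F)"
    using dimension_simple_extension[OF L t] DL(2-4) by simp
  have dS: "dimension 2 S (carrier F)"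
    using dimension_simple_extension[OF S t] DS(2-4) unfolding S_def by simp
  \<comment> \<open>As an \<open>?L\<close>-subspace of the finite-dimensional \<open>F\<close>,
    \<open>S\<close> has some finite dimension \<open>n\<close>; the tower law then gives n * 2 =
    2^m.\<close>
  have "subalgebra ?L S F"
    using subring.axioms(1)[OF subfieldE(1)[OF S]] subringE(6)[OF subfieldE(1)[OF S]] LS
    unfolding subalgebra_def subalgebra_axioms_def by blast
  then obtain n where n: "dimension n ?L S"
    using subalbegra_incl_imp_finite_dimension[OF L finite_dimensionI[OF dL]] subfieldE(3)[OF S] by blast
  have "n * 2 = 2 ^ m"
    using dimension_is_inj[OF L telescopic_base[OF L S n dS] dL] .
  then have "n = 2 ^ (m - 1)" using m by (cases m) auto
  then show ?thesis using n unfolding L_eq Sym by simp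
qed

end
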